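(* Let $X$ be an abelian Polish group. If $A\subset X$ is a Borel set that is not Haar meager and $n\in\mathbb{N}$, then the set $$F_n(A):=\Big\{x\in X:\ \bigcap_{k\in J_n}(A+kx)\ \text{is not Haar meager in } X\Big\},\qquad J_n:=\{-n,\ldots,-1,0,1,\ldots,n\},$$ is a nonempty open subset of $X$.
   Context: An abelian Polish group is an abelian topological group (written additively) whose topology is Polish (separable and completely metrizable). For a set $A\subset X$ and $z\in X$, $A+z=\{a+z: a\in A\}$; $kx$ denotes the $k$-th integer multiple of $x$. $\mathbb{N}$ is the set of positive integers. A set $A\subset X$ is Haar meager if there are a Borel set $B\subset X$ with $A\subset B$, a nonempty compact metric space $K$ and a continuous function $f:K\to X$ such that $f^{-1}(B+x)$ is meager in $K$ for every $x\in X$. *)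

theory Defs
  imports "HOL-Analysis.Analysis"
begin

definition nowhere_dense_in :: "'b topology \<Rightarrow> 'b set \<Rightarrow> bool" where
  "nowhere_dense_in T S \<longleftrightarrow> S \<subseteq> topspace T \<and> T interior_of (T closure_of S) = {}"

definition meager_in :: "'b topology \<Rightarrow> 'b set \<Rightarrow> bool" where
  "meager_in T S \<longleftrightarrow>
     (\<exists>N :: nat \<Rightarrow> 'b set. (\<forall>i. nowhere_dense_in T (N i)) \<and> S = (\<Union>i. N i))"

definition translate :: "'a::plus set \<Rightarrow> 'a \<Rightarrow> 'a set" where
  "translate A z = (\<lambda>a. a + z) ` A"

definition int_multiple :: "int \<Rightarrow> 'a::group_add \<Rightarrow> 'a" where
  "int_multiple k x =
     (if 0 \<le> k then (((+) x) ^^ nat k) 0 else - ((((+) x) ^^ nat (- k)) 0))"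

definition haar_meager_witness ::
  "'a::topological_ab_group_add set \<Rightarrow> 'k metric \<Rightarrow> ('k \<Rightarrow> 'a) \<Rightarrow> bool" where
  "haar_meager_witness B K f \<longleftrightarrow>
     mspace K \<noteq> {} \<and> compact_space (mtopology_of K) \<and>
     continuous_map (mtopology_of K) euclidean f \<and>
     (\<forall>x. meager_in (mtopology_of K) {t \<in> mspace K. f t \<in> translate B x})"

(* The compact metric space K ranges over metrics whose carrier is a set of reals, since one
   cannot quantify over types inside a formula. Nothing is lost: a compact metric space has at
   most continuum many points, so it is isometric to such a space. The lemma haar_meagerI below
   shows that a witnessing space over any type will do. *)
definition haar_meager :: "'a::topological_ab_group_add set \<Rightarrow> bool" where
  "haar_meager A \<longleftrightarrow>
     (\<exists>B \<in> sets borel. A \<subseteq> B \<and>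
        (\<exists>(K :: real metric) f. haar_meager_witness B K f))"

definition F_set :: "nat \<Rightarrow> 'a::topological_ab_group_add set \<Rightarrow> 'a set" where
  "F_set n A =
     {x. \<not> haar_meager (\<Inter>k\<in>{- int n..int n}. translate A (int_multiple k x))}"


lemma nowhere_dense_in_homeomorphic_image:
  assumes h: "homeomorphic_map T U h" and S: "nowhere_dense_in T S"
  shows "nowhere_dense_in U (h ` S)"
proof -
  have sub: "S \<subseteq> topspace T" and e: "T interior_of (T closure_of S) = {}"
    using S by (auto simp: nowhere_dense_in_def)
  have "U interior_of (U closure_of (h ` S)) = h ` (T interior_of (T closure_of S))"
    by (simp add: homeomorphic_map_closure_of[OF h sub]
        homeomorphic_map_interior_of[OF h closure_of_subset_topspace])
  moreover have "h ` S \<subseteq> topspace U"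
    using homeomorphic_imp_surjective_map[OF h] sub by blast
  ultimately show ?thesis
    by (simp add: nowhere_dense_in_def e)
qed

lemma meager_in_homeomorphic_image:
  assumes h: "homeomorphic_map T U h" and S: "meager_in T S"
  shows "meager_in U (h ` S)"
proof -
  obtain N :: "nat \<Rightarrow> _" where N: "\<And>i. nowhere_dense_in T (N i)" "S = (\<Union>i. N i)"
    using S by (auto simp: meager_in_def)
  have "h ` S = (\<Union>i. h ` N i)"
    using N(2) by auto
  with N(1) show ?thesis
    unfolding meager_in_def
    by (intro exI[of _ "\<lambda>i. h ` N i"]) (auto intro: nowhere_dense_in_homeomorphic_image[OF h])
qed

lemma compact_metric_lepoll_real:
  fixes K :: "'k metric"
  assumes "compact_space (mtopology_of K)"
  shows "mspace K \<lesssim> (UNIV :: real set)"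
proof -
  interpret Metric_space "mspace K" "mdist K" by simp
  have tb: "mtotally_bounded (mspace K)"
    using assms compact_space_eq_mcomplete_mtotally_bounded by (simp add: mtopology_of_def)
  have "\<exists>D. finite D \<and> D \<subseteq> mspace K \<and> mspace K \<subseteq> (\<Union>x\<in>D. mball x (1 / real (Suc n)))" for n
    using tb unfolding mtotally_bounded_def by simp
  then obtain D where D: "\<And>n. finite (D n)" "\<And>n. D n \<subseteq> mspace K"
      "\<And>n. mspace K \<subseteq> (\<Union>x\<in>D n. mball x (1 / real (Suc n)))"
    by metis
  define E where "E = (\<Union>n. D n)"
  have "countable E"
    unfolding E_def using D(1) by (auto intro: countable_finite)
  define c where
    "c x = {prod_encode (to_nat_on E d, n) | d n. d \<in> E \<and> mdist K d x < 1 / real (Suc n)}" for x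
  have "inj_on c (mspace K)"
  proof (rule inj_onI, rule ccontr)
    fix x y assume x: "x \<in> mspace K" and y: "y \<in> mspace K" and eq: "c x = c y" and ne: "x \<noteq> y"
    have "0 < mdist K x y"
      using x y ne zero[OF x y] mdist_nonneg[of K x y] by linarith
    then have "0 < mdist K x y / 2" by simp
    then obtain n where n: "1 / real (Suc n) < mdist K x y / 2"
      using nat_approx_posE by blast
    obtain d where d: "d \<in> D n" "x \<in> mball d (1 / real (Suc n))"
      using D(3)[of n] x by blast
    have dE: "d \<in> E" "d \<in> mspace K"
      using d D(2) by (auto simp: E_def)
    have dx: "mdist K d x < 1 / real (Suc n)"
      using d by simp
    then have "prod_encode (to_nat_on E d, n) \<in> c y"
      using dE eq unfolding c_def by blast
    then obtain d' where d': "d' \<in> E" "to_nat_on E d' = to_nat_on E d"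
        "mdist K d' y < 1 / real (Suc n)"
      unfolding c_def by auto
    then have "d' = d"
      using dE \<open>countable E\<close> by (meson inj_on_to_nat_on inj_onD)
    then show False
      using d'(3)[unfolded \<open>d' = d\<close>] dx n mdist_triangle[OF x dE(2) y] mdist_commute[of K x d] by linarith
  qed
  then have "mspace K \<lesssim> (UNIV :: nat set set)"
    by (auto simp: lepoll_def)
  then show ?thesis
    using nat_sets_eqpoll_reals lepoll_trans1 lepoll_trans2 by blast
qed

lemma haar_meagerI:
  fixes K :: "'k metric" and B :: "'a::topological_ab_group_add set"
  assumes "B \<in> sets borel" "A \<subseteq> B" and w: "haar_meager_witness B K f"
  shows "haar_meager A"
proof -
  have ne: "mspace K \<noteq> {}" and cpt: "compact_space (mtopology_of K)"
    and cont: "continuous_map (mtopology_of K) euclidean f"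
    and mea: "\<And>x. meager_in (mtopology_of K) {t \<in> mspace K. f t \<in> translate B x}"
    using w by (auto simp: haar_meager_witness_def)
  obtain h :: "'k \<Rightarrow> real" where inj: "inj_on h (mspace K)"
    using compact_metric_lepoll_real[OF cpt] by (auto simp: lepoll_def)
  define g where "g = inv_into (mspace K) h"
  have g[simp]: "g (h t) = t" if "t \<in> mspace K" for t
    using that inj by (simp add: g_def)
  define M where "M = h ` mspace K"
  define d where "d a b = mdist K (g a) (g b)" for a b
  have "Metric_space M d"
    by unfold_locales (auto simp: M_def d_def mdist_commute intro: mdist_triangle)
  then interpret M: Metric_space M d .
  interpret MK: Metric_space12 "mspace K" "mdist K" M d
    by (simp add: Metric_space12_def M.Metric_space_axioms)
  define L where "L = metric (M, d)"
  have mspL: "mspace L = M"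
    by (simp add: L_def)
  have topK: "mtopology_of K = MK.M1.mtopology"
    by (simp add: mtopology_of_def)
  have topL: "mtopology_of L = M.mtopology"
    by (simp add: L_def)
  have hom: "homeomorphic_map (mtopology_of K) (mtopology_of L) h"
    unfolding topK topL
    by (rule MK.isometry_imp_homeomorphic_map) (auto simp: M_def d_def)
  have contg: "continuous_map (mtopology_of L) (mtopology_of K) g"
    unfolding topK topL M.metric_continuous_map[OF MK.M1.Metric_space_axioms]
    by (auto simp: M_def d_def)
  have "haar_meager_witness B L (f \<circ> g)"
    unfolding haar_meager_witness_def
  proof (intro conjI allI)
    show "mspace L \<noteq> {}"
      using ne by (simp add: mspL M_def)
    show "compact_space (mtopology_of L)"
      using cpt hom homeomorphic_compact_space homeomorphic_map_imp_homeomorphic_space by blast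
    show "continuous_map (mtopology_of L) euclidean (f \<circ> g)"
      using continuous_map_compose[OF contg cont] .
    fix x
    have "{t \<in> mspace L. (f \<circ> g) t \<in> translate B x} = h ` {t \<in> mspace K. f t \<in> translate B x}"
      by (auto simp: mspL M_def)
    then show "meager_in (mtopology_of L) {t \<in> mspace L. (f \<circ> g) t \<in> translate B x}"
      using meager_in_homeomorphic_image[OF hom mea[of x]] by simp
  qed
  with assms(1,2) show ?thesis
    unfolding haar_meager_def by blast
qed

end

theory Submission
  imports Defs
begin

text \<open>
  The set in question contains \<open>0\<close>, since all translates by multiples of \<open>0\<close> are \<open>A\<close> itself. Openness is a
  Steinhaus-type statement. Moving a point \<open>x0\<close> of the set to the origin, that is, replacing \<open>A\<close> by the Borel
  set \<open>C = (\<Inter>k. A + k x0)\<close>, it says: if \<open>C\<close> is not Haar meager, then neither is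
  \<open>C\<^sub>h = (\<Inter>k. C + k h)\<close> for all \<open>h\<close> near \<open>0\<close>. This is proved in contrapositive form, as
  \<open>haar_meager_if_frequently_haar_meager_Inter\<close>.

  Suppose \<open>C\<^sub>h\<close> is Haar meager for \<open>h\<close> arbitrarily close to \<open>0\<close>. Take a sequence \<open>h\<^sub>m\<close> of such points that
  tends to \<open>0\<close> quickly, with witnesses \<open>\<phi>\<^sub>m\<close> on compact spaces \<open>T\<^sub>m\<close> cut down and translated so that their values
  are close to \<open>0\<close> (\<open>small_meager_witness\<close>). Then \<open>f((t\<^sub>m, k\<^sub>m)\<^sub>m) = \<Sum>m. \<phi>\<^sub>m t\<^sub>m + k\<^sub>m h\<^sub>m\<close> converges
  uniformly on the compact metrizable product of the spaces \<open>T\<^sub>m \<times> {-n..n}\<close>, and it witnesses that \<open>C\<close> is Haar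
  meager. Indeed, a nonmeager preimage of a translate of \<open>C\<close> has the Baire property
  (\<open>borel_vimage_Baire_property\<close>), so it is comeager in a box; the box leaves some coordinate \<open>m\<close> free, and
  by Kuratowski--Ulam (\<open>meager_in_sections\<close>) one can fix the other coordinates so that almost all \<open>t\<^sub>m\<close> are
  good for all values of \<open>k\<^sub>m\<close> at once. Being good for all \<open>k\<^sub>m\<close> means that \<open>\<phi>\<^sub>m t\<^sub>m\<close> lies in a fixed translate of
  \<open>C\<close> shifted by every multiple of \<open>h\<^sub>m\<close>, i.e. of \<open>C\<^sub>h\<close> with \<open>h = h\<^sub>m\<close>. But \<open>\<phi>\<^sub>m\<close> maps only a meager
  set of parameters there, contradicting the Baire category theorem on \<open>T\<^sub>m\<close>.
\<close>

section \<open>Category in abstract topological spaces\<close>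

text \<open>The form in which nowhere density is used throughout: it only speaks of open sets avoiding
  \<open>S\<close>, so it passes easily through products, open maps and subspaces.\<close>

lemma nowhere_dense_in_iff_open_subset:
  "nowhere_dense_in T S \<longleftrightarrow> S \<subseteq> topspace T \<and>
     (\<forall>U. openin T U \<and> U \<noteq> {} \<longrightarrow> (\<exists>V. openin T V \<and> V \<noteq> {} \<and> V \<subseteq> U \<and> V \<inter> S = {}))"
proof (intro iffI conjI allI impI)
  assume nd: "nowhere_dense_in T S"
  show "S \<subseteq> topspace T"
    using nd by (simp add: nowhere_dense_in_def)
  fix U assume U: "openin T U \<and> U \<noteq> {}"
  have "\<not> U \<subseteq> T closure_of S"
    using nd U interior_of_maximal[of U "T closure_of S" T] by (auto simp: nowhere_dense_in_def)
  then obtain x where x: "x \<in> U" "x \<notin> T closure_of S"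
    by blast
  then obtain V where "x \<in> V" "openin T V" "V \<inter> S = {}"
    using U openin_subset by (fastforce simp: in_closure_of)
  then show "\<exists>V. openin T V \<and> V \<noteq> {} \<and> V \<subseteq> U \<and> V \<inter> S = {}"
    using x U by (intro exI[of _ "U \<inter> V"]) auto
next
  assume R: "S \<subseteq> topspace T \<and>
     (\<forall>U. openin T U \<and> U \<noteq> {} \<longrightarrow> (\<exists>V. openin T V \<and> V \<noteq> {} \<and> V \<subseteq> U \<and> V \<inter> S = {}))"
  show "nowhere_dense_in T S"
    unfolding nowhere_dense_in_def
  proof (intro conjI)
    show "S \<subseteq> topspace T" using R by blast
    show "T interior_of (T closure_of S) = {}"
    proof (rule ccontr)
      assume "T interior_of (T closure_of S) \<noteq> {}"
      then obtain V where V: "openin T V" "V \<noteq> {}" "V \<subseteq> T interior_of (T closure_of S)" "V \<inter> S = {}"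
        using R by (metis openin_interior_of)
      then have "V \<subseteq> T closure_of S"
        using interior_of_subset by fastforce
      with V(1,2,4) show False
        using openin_Int_closure_of_eq_empty[OF V(1), of S] by blast
    qed
  qed
qed

lemma nowhere_dense_in_empty [simp]: "nowhere_dense_in T {}"
  by (simp add: nowhere_dense_in_def)

lemma nowhere_dense_in_subset:
  assumes "nowhere_dense_in T S" "R \<subseteq> S"
  shows "nowhere_dense_in T R"
  using assms interior_of_mono[OF closure_of_mono[OF assms(2), of T], of T]
  unfolding nowhere_dense_in_def by (simp, blast)

lemma meager_in_subset:
  assumes "meager_in T S" "R \<subseteq> S"
  shows "meager_in T R"
proof -
  obtain N :: "nat \<Rightarrow> _" where N: "\<And>i. nowhere_dense_in T (N i)" "S = (\<Union>i. N i)"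
    using assms by (auto simp: meager_in_def)
  then show ?thesis
    unfolding meager_in_def using assms(2)
    by (intro exI[of _ "\<lambda>i. N i \<inter> R"]) (auto intro: nowhere_dense_in_subset)
qed

lemma meager_in_countable_Union_nowhere_dense:
  assumes "countable I" "\<And>i. i \<in> I \<Longrightarrow> nowhere_dense_in T (N i)"
  shows "meager_in T (\<Union>i\<in>I. N i)"
proof (cases "I = {}")
  case True
  then show ?thesis
    unfolding meager_in_def by (intro exI[of _ "\<lambda>_. {}"]) auto
next
  case False
  then show ?thesis
    unfolding meager_in_def using assms
    by (intro exI[of _ "\<lambda>k. N (from_nat_into I k)"])
       (use from_nat_into[of I] in auto, metis from_nat_into_to_nat_on)
qed

lemma meager_in_countable_Union:
  assumes I: "countable I" and S: "\<And>i. i \<in> I \<Longrightarrow> meager_in T (S i)"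
  shows "meager_in T (\<Union>i\<in>I. S i)"
proof -
  have "\<forall>i\<in>I. \<exists>N :: nat \<Rightarrow> _. (\<forall>k. nowhere_dense_in T (N k)) \<and> S i = (\<Union>k. N k)"
    using S by (auto simp: meager_in_def)
  then obtain N :: "_ \<Rightarrow> nat \<Rightarrow> _"
    where N: "\<And>i k. i \<in> I \<Longrightarrow> nowhere_dense_in T (N i k)" "\<And>i. i \<in> I \<Longrightarrow> S i = (\<Union>k. N i k)"
    by metis
  have "meager_in T (\<Union>q \<in> I \<times> UNIV. N (fst q) (snd q))"
    using I N(1) by (intro meager_in_countable_Union_nowhere_dense) auto
  moreover have "(\<Union>q \<in> I \<times> UNIV. N (fst q) (snd q)) = (\<Union>i\<in>I. S i)"
    using N(2) by force
  ultimately show ?thesis by simp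
qed

lemma meager_in_nowhere_dense: "nowhere_dense_in T S \<Longrightarrow> meager_in T S"
  using meager_in_countable_Union_nowhere_dense[of "{()}" T "\<lambda>_. S"] by simp

lemma meager_in_Un: "meager_in T R \<Longrightarrow> meager_in T S \<Longrightarrow> meager_in T (R \<union> S)"
  using meager_in_countable_Union[of "{True, False}" T "\<lambda>b. if b then R else S"] by (simp add: Un_commute)

lemma compact_metrizable_imp_completely_metrizable:
  assumes "compact_space T" "metrizable_space T"
  shows "completely_metrizable_space T"
proof -
  obtain M d where M: "Metric_space M d" "T = Metric_space.mtopology M d"
    using assms(2) by (auto simp: metrizable_space_def)
  then have "Metric_space.mcomplete M d"
    using assms(1) Metric_space.compact_space_eq_mcomplete_mtotally_bounded by blast
  with M show ?thesis
    unfolding completely_metrizable_space_def by blast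
qed

lemma open_not_meager_in:
  assumes "compact_space T" "metrizable_space T" and U: "openin T U" "U \<noteq> {}"
  shows "\<not> meager_in T U"
proof
  assume "meager_in T U"
  then obtain N :: "nat \<Rightarrow> _" where N: "\<And>i. nowhere_dense_in T (N i)" "U = (\<Union>i. N i)"
    by (auto simp: meager_in_def)
  have "T interior_of \<Union> (range (\<lambda>i. T closure_of N i)) = {}"
    using compact_metrizable_imp_completely_metrizable[OF assms(1,2)] N(1)
    by (intro Baire_category_alt) (auto simp: nowhere_dense_in_def)
  moreover have "U \<subseteq> \<Union> (range (\<lambda>i. T closure_of N i))"
    unfolding N(2) using N(1) closure_of_subset[of "N _" T]
    by (auto simp: nowhere_dense_in_def) blast
  ultimately show False
    using U interior_of_maximal by blast
qed

lemma nowhere_dense_in_closure_minus_open: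
  assumes U: "openin T U"
  shows "nowhere_dense_in T (T closure_of U - U)"
  unfolding nowhere_dense_in_iff_open_subset
proof (intro conjI allI impI)
  show "T closure_of U - U \<subseteq> topspace T"
    using closure_of_subset_topspace by fast
  fix W assume W: "openin T W \<and> W \<noteq> {}"
  show "\<exists>V. openin T V \<and> V \<noteq> {} \<and> V \<subseteq> W \<and> V \<inter> (T closure_of U - U) = {}"
  proof (cases "W \<inter> U = {}")
    case True
    then show ?thesis
      using W openin_Int_closure_of_eq_empty[of T W U] by (intro exI[of _ W]) auto
  next
    case False
    then show ?thesis
      using W U by (intro exI[of _ "W \<inter> U"]) auto
  qed
qed

text \<open>Openness of \<open>h\<close> is what makes preimages of small sets small: an open set of the domain has an open
  image, part of which avoids \<open>N\<close>, and that part is pulled back by continuity.\<close>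

lemma nowhere_dense_in_open_map_vimage:
  assumes cont: "continuous_map X Y h" and op: "open_map X Y h" and N: "nowhere_dense_in Y N"
  shows "nowhere_dense_in X {x \<in> topspace X. h x \<in> N}"
  unfolding nowhere_dense_in_iff_open_subset
proof (intro conjI allI impI)
  fix U assume U: "openin X U \<and> U \<noteq> {}"
  then have "openin Y (h ` U)" "h ` U \<noteq> {}"
    using op by (auto simp: open_map_def)
  then obtain V where V: "openin Y V" "V \<noteq> {}" "V \<subseteq> h ` U" "V \<inter> N = {}"
    using N unfolding nowhere_dense_in_iff_open_subset by blast
  define W where "W = U \<inter> {x \<in> topspace X. h x \<in> V}"
  have "openin X W"
    unfolding W_def using U openin_continuous_map_preimage[OF cont V(1)] by blast
  moreover obtain x where "x \<in> U" "h x \<in> V"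
    using V(2,3) by blast
  then have "W \<noteq> {}"
    using U openin_subset[of X U] unfolding W_def by blast
  moreover have "W \<subseteq> U" "W \<inter> {x \<in> topspace X. h x \<in> N} = {}"
    using V(4) by (auto simp: W_def)
  ultimately show "\<exists>V. openin X V \<and> V \<noteq> {} \<and> V \<subseteq> U \<and> V \<inter> {x \<in> topspace X. h x \<in> N} = {}"
    by blast
qed auto

lemma meager_in_open_map_vimage:
  assumes cont: "continuous_map X Y h" and op: "open_map X Y h" and S: "meager_in Y S"
  shows "meager_in X {x \<in> topspace X. h x \<in> S}"
proof -
  obtain N :: "nat \<Rightarrow> _" where N: "\<And>i. nowhere_dense_in Y (N i)" "S = (\<Union>i. N i)"
    using S by (auto simp: meager_in_def)
  then show ?thesis
    unfolding meager_in_def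
    by (intro exI[of _ "\<lambda>i. {x \<in> topspace X. h x \<in> N i}"])
       (auto intro: nowhere_dense_in_open_map_vimage[OF cont op])
qed

text \<open>An arbitrary closed subspace may lie inside a nowhere dense set. The closure of an open set \<open>U\<close>
  is better behaved, because its nonempty relatively open subsets all meet \<open>U\<close>. This permits cutting
  a compact space down to a small compact piece without losing meagerness.\<close>

lemma nowhere_dense_in_closure_of_open:
  assumes U: "openin T U" and N: "nowhere_dense_in T N"
  shows "nowhere_dense_in (subtopology T (T closure_of U)) (T closure_of U \<inter> N)"
  unfolding nowhere_dense_in_iff_open_subset
proof (intro conjI allI impI)
  show "T closure_of U \<inter> N \<subseteq> topspace (subtopology T (T closure_of U))"
    using N by (auto simp: nowhere_dense_in_def)
  fix W assume W: "openin (subtopology T (T closure_of U)) W \<and> W \<noteq> {}"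
  then obtain W' where W': "openin T W'" "W = W' \<inter> T closure_of U"
    by (auto simp: openin_subtopology)
  have "W' \<inter> U \<noteq> {}"
    using W W' openin_Int_closure_of_eq_empty[OF W'(1), of U] by auto
  then obtain V where V: "openin T V" "V \<noteq> {}" "V \<subseteq> W' \<inter> U" "V \<inter> N = {}"
    using N U W'(1) unfolding nowhere_dense_in_iff_open_subset by (metis openin_Int)
  have "U \<subseteq> T closure_of U"
    using U by (simp add: closure_of_subset openin_subset)
  then show "\<exists>V. openin (subtopology T (T closure_of U)) V \<and> V \<noteq> {} \<and> V \<subseteq> W \<and>
               V \<inter> (T closure_of U \<inter> N) = {}"
    using V W' by (intro exI[of _ V]) (auto simp: openin_subtopology intro!: exI[of _ V])
qed

lemma meager_in_closure_of_open:
  assumes U: "openin T U" and S: "meager_in T S"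
  shows "meager_in (subtopology T (T closure_of U)) (T closure_of U \<inter> S)"
proof -
  obtain N :: "nat \<Rightarrow> _" where N: "\<And>i. nowhere_dense_in T (N i)" "S = (\<Union>i. N i)"
    using S by (auto simp: meager_in_def)
  then show ?thesis
    unfolding meager_in_def
    by (intro exI[of _ "\<lambda>i. T closure_of U \<inter> N i"])
       (auto intro: nowhere_dense_in_closure_of_open[OF U])
qed

text \<open>Borel preimages have the Baire property, by induction over the Borel sets. For complements, the open
  approximation \<open>U\<close> is replaced by the complement of its closure; the error this makes is the boundary
  of \<open>U\<close>, which is nowhere dense.\<close>

lemma borel_vimage_Baire_property:
  fixes f :: "'b \<Rightarrow> 'a::topological_space"
  assumes cont: "continuous_map T euclidean f" and C: "C \<in> sets borel"
  shows "\<exists>U. openin T U \<and> meager_in T (sym_diff U {t \<in> topspace T. f t \<in> C})"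
proof -
  have "C \<in> sigma_sets UNIV {S. open S}"
    using C by (simp add: borel_def)
  then show ?thesis
  proof induction
    case (Basic a)
    then have "openin T {t \<in> topspace T. f t \<in> a}"
      using openin_continuous_map_preimage[OF cont, of a] by simp
    then show ?case
      by (intro exI[of _ "{t \<in> topspace T. f t \<in> a}"]) (simp add: meager_in_nowhere_dense)
  next
    case Empty
    show ?case
      by (intro exI[of _ "{}"]) (simp add: meager_in_nowhere_dense)
  next
    case (Compl a)
    then obtain U where U: "openin T U" "meager_in T (sym_diff U {t \<in> topspace T. f t \<in> a})"
      by blast
    have "meager_in T (sym_diff U {t \<in> topspace T. f t \<in> a} \<union> (T closure_of U - U))"
      using U by (meson meager_in_Un meager_in_nowhere_dense nowhere_dense_in_closure_minus_open)
    moreover have "U \<subseteq> T closure_of U"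
      using U(1) by (simp add: closure_of_subset openin_subset)
    ultimately have "meager_in T
        (sym_diff (topspace T - T closure_of U) {t \<in> topspace T. f t \<in> UNIV - a})"
      using openin_subset[OF U(1)] by (elim meager_in_subset) auto
    moreover have "openin T (topspace T - T closure_of U)"
      by (simp add: openin_diff)
    ultimately show ?case
      by (intro exI[of _ "topspace T - T closure_of U"] conjI)
  next
    case (Union a)
    have "\<exists>U. \<forall>i. openin T (U i) \<and> meager_in T (sym_diff (U i) {t \<in> topspace T. f t \<in> a i})"
      using Union.IH by (intro choice allI)
    then obtain U where U: "\<And>i. openin T (U i)"
        "\<And>i. meager_in T (sym_diff (U i) {t \<in> topspace T. f t \<in> a i})"
      by auto
    have "meager_in T (\<Union>i. sym_diff (U i) {t \<in> topspace T. f t \<in> a i})"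
      using U(2) by (intro meager_in_countable_Union) auto
    then have "meager_in T (sym_diff (\<Union>i. U i) {t \<in> topspace T. f t \<in> (\<Union>i. a i)})"
      by (rule meager_in_subset) auto
    moreover have "openin T (\<Union>i. U i)"
      using U(1) by blast
    ultimately show ?case
      by (intro exI[of _ "\<Union>i. U i"] conjI)
  qed
qed

text \<open>The balls of radius \<open>1 / (n + 1)\<close> around finitely many centres, for each \<open>n\<close>. A countable family that
  is cofinal among the nonempty open sets is all that the Kuratowski--Ulam argument needs.\<close>

lemma compact_metrizable_countable_pi_base:
  assumes "compact_space T" "metrizable_space T"
  obtains \<B> where "countable \<B>" "\<And>V. V \<in> \<B> \<Longrightarrow> openin T V \<and> V \<noteq> {}"
    "\<And>U. openin T U \<Longrightarrow> U \<noteq> {} \<Longrightarrow> \<exists>V\<in>\<B>. V \<subseteq> U"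
proof -
  obtain M d where Md: "Metric_space M d" "T = Metric_space.mtopology M d"
    using assms(2) by (auto simp: metrizable_space_def)
  interpret Metric_space M d by fact
  have "mtotally_bounded M"
    using assms(1) Md(2) compact_space_eq_mcomplete_mtotally_bounded by simp
  then have "\<exists>D. finite D \<and> D \<subseteq> M \<and> M \<subseteq> (\<Union>x\<in>D. mball x (1 / real (Suc n)))" for n
    unfolding mtotally_bounded_def by simp
  then obtain D where D: "\<And>n. finite (D n)" "\<And>n. D n \<subseteq> M"
      "\<And>n. M \<subseteq> (\<Union>x\<in>D n. mball x (1 / real (Suc n)))"
    by metis
  define \<B> where "\<B> = (\<Union>n. (\<lambda>x. mball x (1 / real (Suc n))) ` D n)"
  show thesis
  proof
    show "countable \<B>"
      unfolding \<B>_def using D(1) by (auto intro: countable_finite)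
    show "openin T V \<and> V \<noteq> {}" if "V \<in> \<B>" for V
    proof -
      obtain n x where "x \<in> D n" "V = mball x (1 / real (Suc n))"
        using \<open>V \<in> \<B>\<close> by (auto simp: \<B>_def)
      moreover have "x \<in> M" using D(2) \<open>x \<in> D n\<close> by blast
      ultimately show ?thesis
        unfolding Md(2) using centre_in_mball_iff[of x "1 / real (Suc n)"]
        by (metis empty_iff of_nat_0_less_iff openin_mball zero_less_Suc zero_less_divide_1_iff)
    qed
    fix U assume U: "openin T U" "U \<noteq> {}"
    then obtain x where x: "x \<in> U" "x \<in> M"
      using Md(2) openin_mtopology by blast
    then obtain r where r: "r > 0" "mball x r \<subseteq> U"
      using U(1) unfolding Md(2) openin_mtopology by blast
    obtain n where n: "1 / real (Suc n) < r / 2"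
      using r(1) nat_approx_posE[of "r / 2"] by auto
    obtain c where c: "c \<in> D n" "x \<in> mball c (1 / real (Suc n))"
      using D(3)[of n] x(2) by blast
    have "mball c (1 / real (Suc n)) \<subseteq> mball x r"
    proof
      fix y assume "y \<in> mball c (1 / real (Suc n))"
      then show "y \<in> mball x r"
        using c(2) n triangle[of x c y] commute[of x c] by auto
    qed
    then show "\<exists>V\<in>\<B>. V \<subseteq> U"
      using c(1) r(2) unfolding \<B>_def by blast
  qed
qed

text \<open>One half of the Kuratowski--Ulam theorem. If the section of a nowhere dense set \<open>N\<close> at \<open>z\<close> fails to be
  nowhere dense, then it is dense in some member \<open>V\<close> of a countable \<open>\<pi>\<close>-base. For each fixed \<open>V\<close> such
  \<open>z\<close> form a nowhere dense set, since any box \<open>U \<times> V\<close> contains a smaller box missing \<open>N\<close>.\<close>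

lemma meager_in_sections:
  assumes L: "compact_space L" "metrizable_space L" and S: "meager_in (prod_topology Z L) S"
  shows "meager_in Z {z \<in> topspace Z. \<not> meager_in L {v \<in> topspace L. (z, v) \<in> S}}"
proof -
  obtain \<B> where \<B>: "countable \<B>" "\<And>V. V \<in> \<B> \<Longrightarrow> openin L V \<and> V \<noteq> {}"
    "\<And>U. openin L U \<Longrightarrow> U \<noteq> {} \<Longrightarrow> \<exists>V\<in>\<B>. V \<subseteq> U"
    using compact_metrizable_countable_pi_base[OF L] by metis
  obtain N :: "nat \<Rightarrow> _" where N: "\<And>i. nowhere_dense_in (prod_topology Z L) (N i)" "S = (\<Union>i. N i)"
    using S by (auto simp: meager_in_def)
  \<comment> \<open>the points at which the section of the \<open>i\<close>-th nowhere dense set is dense in \<open>V\<close>\<close>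
  define E where "E i V = {z \<in> topspace Z. \<forall>V'\<in>\<B>. V' \<subseteq> V \<longrightarrow> (\<exists>v\<in>V'. (z, v) \<in> N i)}" for i V
  have nd: "nowhere_dense_in Z (E i V)" if "V \<in> \<B>" for i V
    unfolding nowhere_dense_in_iff_open_subset
  proof (intro conjI allI impI)
    show "E i V \<subseteq> topspace Z" by (auto simp: E_def)
    fix U assume U: "openin Z U \<and> U \<noteq> {}"
    then have "openin (prod_topology Z L) (U \<times> V)" "U \<times> V \<noteq> {}"
      using \<B>(2)[OF that] by (auto simp: openin_prod_Times_iff)
    then obtain W where W: "openin (prod_topology Z L) W" "W \<noteq> {}" "W \<subseteq> U \<times> V" "W \<inter> N i = {}"
      using N(1)[of i] unfolding nowhere_dense_in_iff_open_subset by blast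
    then obtain a b where ab: "(a, b) \<in> W" by auto
    then obtain U' V' where UV: "openin Z U'" "openin L V'" "a \<in> U'" "b \<in> V'" "U' \<times> V' \<subseteq> W"
      using W(1) by (metis openin_prod_topology_alt)
    then obtain V'' where V'': "V'' \<in> \<B>" "V'' \<subseteq> V'"
      using \<B>(3)[of V'] by auto
    have "z \<notin> E i V" if "z \<in> U'" for z
    proof -
      have "\<not> (\<exists>v\<in>V''. (z, v) \<in> N i)" "V'' \<subseteq> V"
        using that V''(2) UV(3-5) W(3,4) by blast+
      then show ?thesis
        using V''(1) by (auto simp: E_def)
    qed
    then show "\<exists>V'. openin Z V' \<and> V' \<noteq> {} \<and> V' \<subseteq> U \<and> V' \<inter> E i V = {}"
      using UV W(3) by (intro exI[of _ U']) auto
  qed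
  have "meager_in Z (\<Union>q \<in> UNIV \<times> \<B>. E (fst q) (snd q))"
    using \<B>(1) nd by (intro meager_in_countable_Union_nowhere_dense) auto
  then show ?thesis
  proof (rule meager_in_subset, safe)
    fix z assume z: "z \<in> topspace Z" and nm: "\<not> meager_in L {v \<in> topspace L. (z, v) \<in> S}"
    have "\<exists>i. \<not> nowhere_dense_in L {v \<in> topspace L. (z, v) \<in> N i}"
    proof (rule ccontr)
      assume "\<nexists>i. \<not> nowhere_dense_in L {v \<in> topspace L. (z, v) \<in> N i}"
      then have "meager_in L {v \<in> topspace L. (z, v) \<in> S}"
        unfolding meager_in_def N(2)
        by (intro exI[of _ "\<lambda>i. {v \<in> topspace L. (z, v) \<in> N i}"]) auto
      with nm show False by simp
    qed
    then obtain i where "\<not> nowhere_dense_in L {v \<in> topspace L. (z, v) \<in> N i}" by metis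
    moreover define Q where "Q = {v \<in> topspace L. (z, v) \<in> N i}"
    moreover have "Q \<subseteq> topspace L"
      by (auto simp: Q_def)
    ultimately obtain U where U: "openin L U" "U \<noteq> {}"
      "\<And>V. openin L V \<Longrightarrow> V \<noteq> {} \<Longrightarrow> V \<subseteq> U \<Longrightarrow> V \<inter> Q \<noteq> {}"
      unfolding nowhere_dense_in_iff_open_subset by metis
    obtain V where V: "V \<in> \<B>" "V \<subseteq> U"
      using \<B>(3)[OF U(1,2)] by blast
    have "z \<in> E i V"
      unfolding E_def
    proof (intro CollectI conjI ballI impI z)
      fix V' assume "V' \<in> \<B>" "V' \<subseteq> V"
      then have "V' \<inter> Q \<noteq> {}"
        using U(3) \<B>(2) V(2) by (meson order_trans)
      then show "\<exists>v\<in>V'. (z, v) \<in> N i" unfolding Q_def by blast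
    qed
    then show "z \<in> (\<Union>q \<in> UNIV \<times> \<B>. E (fst q) (snd q))"
      using V(1) by force
  qed
qed

section \<open>Multiples and translates\<close>

lemma int_multiple_zero_left [simp]: "int_multiple 0 x = 0"
  by (simp add: int_multiple_def)

lemma int_multiple_minus_left: "int_multiple (- k) x = - int_multiple k x"
  by (auto simp: int_multiple_def)

lemma int_multiple_add_right:
  fixes x y :: "'a::ab_group_add"
  shows "int_multiple k (x + y) = int_multiple k x + int_multiple k y"
proof -
  have "(((+) (x + y)) ^^ m) 0 = (((+) x) ^^ m) 0 + (((+) y) ^^ m) 0" for m
    by (induction m) (simp_all add: algebra_simps)
  then show ?thesis
    by (simp add: int_multiple_def)
qed

lemma int_multiple_zero_right [simp]: "int_multiple k (0::'a::group_add) = 0"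
proof -
  have "(((+) (0::'a)) ^^ m) 0 = 0" for m
    by (induction m) auto
  then show ?thesis
    by (simp add: int_multiple_def)
qed

lemma tendsto_int_multiple [tendsto_intros]:
  fixes f :: "'b \<Rightarrow> 'a::topological_group_add"
  assumes "(f \<longlongrightarrow> l) F"
  shows "((\<lambda>x. int_multiple k (f x)) \<longlongrightarrow> int_multiple k l) F"
proof -
  have "((\<lambda>x. (((+) (f x)) ^^ m) 0) \<longlongrightarrow> (((+) l) ^^ m) 0) F" for m
    by (induction m) (auto intro!: tendsto_intros assms)
  then show ?thesis
    by (auto simp: int_multiple_def intro!: tendsto_intros)
qed

lemma mem_translate_iff: "y \<in> translate A z \<longleftrightarrow> y - z \<in> A"
  for z :: "'a::group_add"
  by (force simp: translate_def image_iff)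

lemma borel_translate:
  fixes A :: "'a::{topological_group_add, second_countable_topology} set"
  assumes "A \<in> sets borel"
  shows "translate A z \<in> sets borel"
proof -
  have "(\<lambda>a. a - z) \<in> borel_measurable borel"
    by (intro borel_measurable_continuous_onI) (auto simp: continuous_on_def intro!: tendsto_intros)
  moreover have "translate A z = (\<lambda>a. a - z) -` A \<inter> space borel"
    by (auto simp: mem_translate_iff)
  ultimately show ?thesis
    using measurable_sets assms by metis
qed

lemma haar_meager_mono: "haar_meager S \<Longrightarrow> R \<subseteq> S \<Longrightarrow> haar_meager R"
  unfolding haar_meager_def by blast

section \<open>Infinite sums of independent coordinates\<close>

lemma continuous_map_partial_sum:
  fixes g :: "nat \<Rightarrow> 'b \<Rightarrow> 'a::topological_ab_group_add"
  assumes "\<And>i. continuous_map (Y i) euclidean (g i)"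
  shows "continuous_map (product_topology Y UNIV) euclidean (\<lambda>p. \<Sum>k<m. g k (p k))"
proof (induction m)
  case 0
  then show ?case by simp
next
  case (Suc m)
  have "continuous_map (product_topology Y UNIV) euclidean (\<lambda>p. g m (p m))"
    using continuous_map_compose[OF continuous_map_product_projection[of m UNIV Y] assms]
    by (simp add: o_def)
  with Suc show ?case
    by (auto simp: continuous_map_atin tendsto_add)
qed

text \<open>A sum of functions of separate coordinates converges uniformly once its increments are small, so it is
  continuous. The second conclusion makes the coordinates independent of each other; it is
  inherited from the partial sums, as addition is continuous.\<close>

lemma continuous_map_infinite_sum:
  fixes g :: "nat \<Rightarrow> 'b \<Rightarrow> 'a::{topological_ab_group_add, complete_space}"
  assumes cont: "\<And>i. continuous_map (Y i) euclidean (g i)"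
    and small: "\<And>p m. p \<in> topspace (product_topology Y UNIV) \<Longrightarrow>
      dist (\<Sum>k<m. g k (p k)) (\<Sum>k<Suc m. g k (p k)) \<le> (1/2) ^ m"
  obtains f where "continuous_map (product_topology Y UNIV) euclidean f"
    "\<And>p m y. p \<in> topspace (product_topology Y UNIV) \<Longrightarrow> y \<in> topspace (Y m) \<Longrightarrow>
       f (p(m := y)) = f p - g m (p m) + g m y"
proof -
  define s where "s m p = (\<Sum>k<m. g k (p k))" for m p
  define P where "P = product_topology Y UNIV"
  have P: "p \<in> topspace P \<longleftrightarrow> (\<forall>i. p i \<in> topspace (Y i))" for p
    by (auto simp: P_def PiE_iff)
  have le: "dist (s m p) (s (m + k) p) \<le> 2 * (1/2) ^ m - 2 * (1/2) ^ (m + k)"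
    if "p \<in> topspace P" for p m k
  proof (induction k)
    case (Suc k)
    have "dist (s (m + k) p) (s (m + Suc k) p) \<le> (1/2) ^ (m + k)"
      using small[of p "m + k"] that by (simp add: s_def P_def)
    with Suc show ?case
      using dist_triangle[of "s m p" "s (m + Suc k) p" "s (m + k) p"] by simp
  qed simp
  have le2: "dist (s m p) (s m' p) \<le> 2 * (1/2) ^ N"
    if "p \<in> topspace P" "N \<le> m" "N \<le> m'" for p m m' N
  proof -
    have *: "dist (s a p) (s b p) \<le> 2 * (1/2) ^ N" if "N \<le> a" "a \<le> b" for a b
    proof -
      have "dist (s a p) (s b p) \<le> 2 * (1/2) ^ a - 2 * (1/2) ^ b"
        using le[OF \<open>p \<in> topspace P\<close>, of a "b - a"] \<open>a \<le> b\<close> by simp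
      also have "\<dots> \<le> 2 * (1/2) ^ a"
        by simp
      also have "\<dots> \<le> 2 * (1/2) ^ N"
        using \<open>N \<le> a\<close> by (simp add: power_decreasing)
      finally show ?thesis .
    qed
    show ?thesis
      using *[of m m'] *[of m' m] that(2,3) by (cases "m \<le> m'") (auto simp: dist_commute)
  qed
  have Cau: "\<exists>N. \<forall>m n p. N \<le> m \<longrightarrow> N \<le> n \<longrightarrow> p \<in> topspace P \<longrightarrow> dist (s m p) (s n p) < e"
    if "e > 0" for e
  proof -
    obtain N where "(1/2::real) ^ N < e / 2"
      using real_arch_pow_inv[of "e / 2" "1/2"] \<open>e > 0\<close> by auto
    then have "2 * (1/2::real) ^ N < e"
      by simp
    then show ?thesis
      using le2 by (meson le_less_trans)
  qed
  have comp: "Met_TC.mcomplete TYPE('a)"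
    using complete_UNIV by simp
  have conts: "\<forall>\<^sub>F m in sequentially. continuous_map P Met_TC.mtopology (s m)"
    using continuous_map_partial_sum[of Y g, OF cont] by (simp add: P_def s_def[abs_def])
  obtain f where f: "continuous_map P (Met_TC.mtopology) f"
    and lim: "\<And>e. 0 < e \<Longrightarrow> \<forall>\<^sub>F m in sequentially. \<forall>p\<in>topspace P. dist (s m p) (f p) < e"
  proof (rule Met_TC.continuous_map_uniformly_Cauchy_limit[OF comp conts Cau])
    fix f
    assume "continuous_map P Met_TC.mtopology f"
      "\<And>e. 0 < e \<Longrightarrow> \<forall>\<^sub>F m in sequentially. \<forall>p\<in>topspace P. dist (s m p) (f p) < e"
    then show thesis
      by (rule that)
  qed
  have tends: "(\<lambda>m. s m p) \<longlonglongrightarrow> f p" if "p \<in> topspace P" for p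
  proof (rule tendstoI)
    fix e :: real assume "e > 0"
    from lim[OF this] show "\<forall>\<^sub>F m in sequentially. dist (s m p) (f p) < e"
      by (rule eventually_mono) (use that in blast)
  qed
  show thesis
  proof
    show "continuous_map (product_topology Y UNIV) euclidean f"
      using f by (simp add: P_def)
    fix p m y
    assume "p \<in> topspace (product_topology Y UNIV)" and y: "y \<in> topspace (Y m)"
    then have in_P: "p \<in> topspace P" "p(m := y) \<in> topspace P"
      unfolding P_def[symmetric] by (auto simp: P)
    have upd: "s n (p(m := y)) = s n p - g m (p m) + g m y" if "m < n" for n
    proof -
      have "s n q = g m (q m) + (\<Sum>k\<in>{..<n} - {m}. g k (q k))" for q
        unfolding s_def using that by (intro sum.remove) auto
      moreover have "(\<Sum>k\<in>{..<n} - {m}. g k ((p(m := y)) k)) = (\<Sum>k\<in>{..<n} - {m}. g k (p k))"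
        by (intro sum.cong) auto
      ultimately show ?thesis
        by (simp add: algebra_simps)
    qed
    have "(\<lambda>n. s n (p(m := y))) \<longlonglongrightarrow> f p - g m (p m) + g m y"
    proof (rule Lim_transform_eventually)
      show "(\<lambda>n. s n p - g m (p m) + g m y) \<longlonglongrightarrow> f p - g m (p m) + g m y"
        by (intro tendsto_intros tends in_P)
      show "\<forall>\<^sub>F n in sequentially. s n p - g m (p m) + g m y = s n (p(m := y))"
        using eventually_gt_at_top[of m] by eventually_elim (simp add: upd)
    qed
    then show "f (p(m := y)) = f p - g m (p m) + g m y"
      using tends[OF in_P(2)] LIMSEQ_unique by blast
  qed
qed

text \<open>The metric of a Polish group need not be translation invariant, but over a compact set small translations
  are uniformly small, by continuity of \<open>(a, v) \<mapsto> dist a (a + v)\<close> and compactness.\<close>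

lemma compact_uniform_small_translation:
  fixes P :: "'a::{topological_ab_group_add, metric_space} set"
  assumes "compact P" and "e > 0"
  shows "\<forall>\<^sub>F v in nhds 0. \<forall>a\<in>P. dist a (a + v) < e"
proof -
  have "\<forall>a\<in>P. \<exists>U. open U \<and> a \<in> U \<and> (\<forall>\<^sub>F v in nhds 0. \<forall>b\<in>U. dist b (b + v) < e)"
  proof
    fix a
    have "((\<lambda>q. dist (fst q) (fst q + snd q)) \<longlongrightarrow> dist a (a + 0)) (nhds a \<times>\<^sub>F nhds (0::'a))"
      by (intro tendsto_intros filterlim_fst filterlim_snd)
    then have "\<forall>\<^sub>F q in nhds a \<times>\<^sub>F nhds 0. dist (fst q) (fst q + snd q) < e"
      using \<open>e > 0\<close> by (auto dest: order_tendstoD(2))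
    then obtain Q R where QR: "eventually Q (nhds a)" "eventually R (nhds 0)"
      "\<And>b v. Q b \<Longrightarrow> R v \<Longrightarrow> dist b (b + v) < e"
      by (auto simp: eventually_prod_filter)
    then obtain U where "open U" "a \<in> U" "\<And>b. b \<in> U \<Longrightarrow> Q b"
      by (auto simp: eventually_nhds)
    moreover have "\<forall>\<^sub>F v in nhds 0. \<forall>b\<in>U. dist b (b + v) < e"
      using QR(2) by eventually_elim (use QR(3) \<open>\<And>b. b \<in> U \<Longrightarrow> Q b\<close> in blast)
    ultimately show "\<exists>U. open U \<and> a \<in> U \<and> (\<forall>\<^sub>F v in nhds 0. \<forall>b\<in>U. dist b (b + v) < e)"
      by blast
  qed
  then have "\<exists>U. \<forall>a\<in>P. open (U a) \<and> a \<in> U a \<and> (\<forall>\<^sub>F v in nhds 0. \<forall>b\<in>U a. dist b (b + v) < e)"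
    by (rule bchoice)
  then obtain U where U: "\<And>a. a \<in> P \<Longrightarrow> open (U a)" "\<And>a. a \<in> P \<Longrightarrow> a \<in> U a"
      "\<And>a. a \<in> P \<Longrightarrow> \<forall>\<^sub>F v in nhds 0. \<forall>b\<in>U a. dist b (b + v) < e"
    by auto
  obtain D where D: "D \<subseteq> P" "finite D" "P \<subseteq> (\<Union>a\<in>D. U a)"
  proof (rule compactE_image[OF \<open>compact P\<close>, of P U])
    show "P \<subseteq> (\<Union>a\<in>P. U a)"
      using U(2) by blast
  qed (use U(1) in auto)
  have "\<forall>\<^sub>F v in nhds 0. \<forall>a\<in>D. \<forall>b\<in>U a. dist b (b + v) < e"
    using D U(3) by (intro eventually_ball_finite) auto
  then show ?thesis
    by eventually_elim (use D(3) in blast)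
qed

lemma eventually_plus_int_multiple:
  fixes V :: "'a::topological_ab_group_add \<Rightarrow> bool"
  assumes "\<forall>\<^sub>F v in nhds 0. V v" and "finite J"
  obtains W U where "\<forall>\<^sub>F u in nhds 0. W u" "\<forall>\<^sub>F h in nhds 0. U h"
    "\<And>u h k. W u \<Longrightarrow> U h \<Longrightarrow> k \<in> J \<Longrightarrow> V (u + int_multiple k h)"
proof -
  have "\<forall>\<^sub>F q in nhds 0 \<times>\<^sub>F nhds 0. \<forall>k\<in>J. V (fst q + int_multiple k (snd q))"
  proof (intro eventually_ball_finite ballI)
    fix k
    have "((\<lambda>q. fst q + int_multiple k (snd q)) \<longlongrightarrow> 0 + int_multiple k (0::'a)) (nhds 0 \<times>\<^sub>F nhds 0)"
      by (intro tendsto_intros filterlim_fst filterlim_snd)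
    then show "\<forall>\<^sub>F q in nhds 0 \<times>\<^sub>F nhds 0. V (fst q + int_multiple k (snd q))"
      using assms(1) by (simp add: filterlim_iff)
  qed (fact assms(2))
  then show thesis
    using that unfolding eventually_prod_filter by fastforce
qed

section \<open>Haar meager witnesses near the identity\<close>

text \<open>One summand of the infinite sum. From a witness \<open>f\<close> on \<open>K\<close> for the intersection of shifts, fix a point
  \<open>t0\<close> and restrict \<open>f - f t0\<close> to the closure of an open set of points on which it is close to \<open>0\<close>. The
  translation by \<open>f t0\<close> is harmless because all translates are tested, and the restriction is harmless because
  the subspace is the closure of an open set. The parameter \<open>h\<close> is small as well, so that every value
  \<open>\<phi> t + k h\<close> moves points of the given compact set by less than \<open>e\<close>.\<close>

lemma small_meager_witness:
  fixes C :: "'a::{topological_ab_group_add, metric_space} set"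
  assumes freq: "\<exists>\<^sub>F h in nhds 0. haar_meager (\<Inter>k\<in>J. translate C (int_multiple k h))"
    and J: "finite J" and P: "compact P" and e: "e > 0"
  obtains T :: "real topology" and \<phi> h where
    "compact_space T" "metrizable_space T" "topspace T \<noteq> {}" "continuous_map T euclidean \<phi>"
    "\<And>x. meager_in T {t \<in> topspace T.
        \<phi> t \<in> translate (\<Inter>k\<in>J. translate C (int_multiple k h)) x}"
    "\<And>a t k. a \<in> P \<Longrightarrow> t \<in> topspace T \<Longrightarrow> k \<in> J \<Longrightarrow>
        dist a (a + (\<phi> t + int_multiple k h)) < e"
proof -
  define V where "V v \<longleftrightarrow> (\<forall>a\<in>P. dist a (a + v) < e)" for v
  have "\<forall>\<^sub>F v in nhds 0. V v"
    unfolding V_def using P e by (rule compact_uniform_small_translation)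
  then obtain W U where WU: "\<forall>\<^sub>F u in nhds 0. W u" "\<forall>\<^sub>F h in nhds 0. U h"
    "\<And>u h k. W u \<Longrightarrow> U h \<Longrightarrow> k \<in> J \<Longrightarrow> V (u + int_multiple k h)"
    using eventually_plus_int_multiple[of V J] J by blast
  obtain d where d: "d > 0" "\<And>u. dist u 0 < d \<Longrightarrow> W u"
    using WU(1) by (auto simp: eventually_nhds_metric)
  define r where "r = d / 2"
  have r: "r > 0" "\<And>u. u \<in> cball 0 r \<Longrightarrow> W u"
    using d by (auto simp: r_def dist_commute)
  have "\<exists>\<^sub>F h in nhds 0. U h \<and> haar_meager (\<Inter>k\<in>J. translate C (int_multiple k h))"
    using frequently_eventually_frequently[OF freq WU(2)] by (simp add: conj_commute)
  then obtain h where h: "U h" "haar_meager (\<Inter>k\<in>J. translate C (int_multiple k h))"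
    using frequently_ex by blast
  define Ch where "Ch = (\<Inter>k\<in>J. translate C (int_multiple k h))"
  obtain B and K :: "real metric" and f where B: "Ch \<subseteq> B" and w: "haar_meager_witness B K f"
    using h(2) unfolding haar_meager_def Ch_def by blast
  define X where "X = mtopology_of K"
  have X: "topspace X = mspace K" "metrizable_space X"
    by (simp_all add: X_def mtopology_of_def Metric_space.metrizable_space_mtopology
        Metric_space.topspace_mtopology)
  have K: "mspace K \<noteq> {}" "compact_space X" "continuous_map X euclidean f"
    "\<And>x. meager_in X {t \<in> mspace K. f t \<in> translate B x}"
    using w by (auto simp: haar_meager_witness_def X_def)
  obtain t0 where t0: "t0 \<in> mspace K"
    using K(1) by blast
  define \<phi> where "\<phi> t = f t - f t0" for t
  have cont: "continuous_map X euclidean \<phi>"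
    using K(3) by (auto simp: \<phi>_def[abs_def] continuous_map_atin intro!: tendsto_intros)
  define O1 where "O1 = {t \<in> topspace X. \<phi> t \<in> ball 0 r}"
  define R where "R = X closure_of O1"
  have O1: "openin X O1" "t0 \<in> O1"
    using openin_continuous_map_preimage[OF cont, of "ball 0 r"] t0 r(1)
    by (auto simp: O1_def X \<phi>_def)
  have R: "closedin X R" "O1 \<subseteq> R" "R \<subseteq> topspace X"
    using O1(1) by (auto simp: R_def closure_of_subset openin_subset closure_of_subset_topspace)
  have R_small: "\<phi> t \<in> cball 0 r" if "t \<in> R" for t
  proof -
    have "R \<subseteq> {t \<in> topspace X. \<phi> t \<in> cball 0 r}"
      unfolding R_def using closedin_continuous_map_preimage[OF cont, of "cball 0 r"]
      by (intro closure_of_minimal) (auto simp: O1_def)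
    then show ?thesis using that by blast
  qed
  define T where "T = subtopology X R"
  have T: "topspace T = R"
    using R(3) by (auto simp: T_def)
  show thesis
  proof
    show "compact_space T"
      using R(1) K(2) closedin_compact_space compact_space_subtopology by (auto simp: T_def)
    show "metrizable_space T"
      using X(2) by (simp add: T_def metrizable_space_subtopology)
    show "topspace T \<noteq> {}"
      using O1(2) R(2) T by blast
    show "continuous_map T euclidean \<phi>"
      using cont by (simp add: T_def continuous_map_from_subtopology)
    fix x
    have "meager_in T (R \<inter> {t \<in> mspace K. f t \<in> translate B (x + f t0)})"
      unfolding T_def R_def by (rule meager_in_closure_of_open[OF O1(1) K(4)])
    moreover have "{t \<in> topspace T. \<phi> t \<in> translate Ch x} \<subseteq>
        R \<inter> {t \<in> mspace K. f t \<in> translate B (x + f t0)}"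
      using B R(3) unfolding T X(1)[symmetric] by (auto simp: mem_translate_iff \<phi>_def algebra_simps)
    ultimately show "meager_in T {t \<in> topspace T.
        \<phi> t \<in> translate (\<Inter>k\<in>J. translate C (int_multiple k h)) x}"
      unfolding Ch_def[symmetric] by (rule meager_in_subset)
  next
    fix a t k assume "a \<in> P" "t \<in> topspace T" "k \<in> J"
    then show "dist a (a + (\<phi> t + int_multiple k h)) < e"
      using WU(3)[OF r(2)[OF R_small] h(1)] unfolding T V_def by blast
  qed
qed

lemma continuous_map_plus_int_multiple:
  fixes \<phi> :: "'b \<Rightarrow> 'a::topological_ab_group_add"
  assumes "continuous_map T euclidean \<phi>"
  shows "continuous_map (prod_topology T (discrete_topology J)) euclidean
           (\<lambda>(t, k). \<phi> t + int_multiple k h)"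
proof -
  let ?Y = "prod_topology T (discrete_topology J)"
  have "continuous_map ?Y euclidean (\<lambda>q. \<phi> (fst q))"
    using continuous_map_compose[OF continuous_map_fst assms] by (simp add: o_def)
  moreover have "continuous_map ?Y euclidean (\<lambda>q. int_multiple (snd q) h)"
  proof -
    have "continuous_map (discrete_topology J) euclidean (\<lambda>k. int_multiple k h)"
      by simp
    from continuous_map_compose[OF continuous_map_snd this] show ?thesis
      by (simp add: o_def)
  qed
  ultimately show ?thesis
    by (auto simp: continuous_map_atin case_prod_unfold intro!: tendsto_intros)
qed

text \<open>The pieces have to be chosen one after another: how small the next one must be depends on the compact
  set of partial sums produced so far, since smallness of a translation is only uniform over compact sets.\<close>

lemma summable_meager_witnesses:
  fixes C :: "'a::{topological_ab_group_add, metric_space} set"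
  assumes freq: "\<exists>\<^sub>F h in nhds 0. haar_meager (\<Inter>k\<in>J. translate C (int_multiple k h))"
    and J: "finite J"
  obtains T :: "nat \<Rightarrow> real topology" and \<phi> h where
    "\<And>m. compact_space (T m)" "\<And>m. metrizable_space (T m)" "\<And>m. topspace (T m) \<noteq> {}"
    "\<And>m. continuous_map (T m) euclidean (\<phi> m)"
    "\<And>m x. meager_in (T m) {t \<in> topspace (T m).
        \<phi> m t \<in> translate (\<Inter>k\<in>J. translate C (int_multiple k (h m))) x}"
    "\<And>m p. \<forall>i. p i \<in> topspace (T i) \<times> J \<Longrightarrow>
      dist (\<Sum>i<m. (\<lambda>(t, k). \<phi> i t + int_multiple k (h i)) (p i))
           (\<Sum>i<Suc m. (\<lambda>(t, k). \<phi> i t + int_multiple k (h i)) (p i)) \<le> (1/2) ^ m"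
proof -
  \<comment> \<open>\<open>D\<close> is an admissible choice for the \<open>m\<close>-th piece when the partial sums so far lie in \<open>P\<close>\<close>
  define good where "good P m D \<longleftrightarrow> (case D of (T :: real topology, \<phi>, h) \<Rightarrow>
    compact_space T \<and> metrizable_space T \<and> topspace T \<noteq> {} \<and> continuous_map T euclidean \<phi> \<and>
    (\<forall>x. meager_in T {t \<in> topspace T. \<phi> t \<in> translate (\<Inter>k\<in>J. translate C (int_multiple k h)) x}) \<and>
    (\<forall>a\<in>P. \<forall>t\<in>topspace T. \<forall>k\<in>J. dist a (a + (\<phi> t + int_multiple k h)) < (1/2) ^ m))" for P D and m :: nat
  have "\<exists>D. good P m D" if cP: "compact P" for P m
  proof -
    obtain T :: "real topology" and \<phi> h where *:
      "compact_space T" "metrizable_space T" "topspace T \<noteq> {}" "continuous_map T euclidean \<phi>"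
      "\<And>x. meager_in T {t \<in> topspace T. \<phi> t \<in> translate (\<Inter>k\<in>J. translate C (int_multiple k h)) x}"
      "\<And>a t k. a \<in> P \<Longrightarrow> t \<in> topspace T \<Longrightarrow> k \<in> J \<Longrightarrow>
          dist a (a + (\<phi> t + int_multiple k h)) < (1/2) ^ m"
      by (rule small_meager_witness[OF freq J cP, of "(1/2) ^ m"]) auto
    have "good P m (T, \<phi>, h)"
      unfolding good_def prod.case using * by (intro conjI allI ballI)
    then show ?thesis ..
  qed
  then obtain D where D: "\<And>P m. compact P \<Longrightarrow> good P m (D P m)"
    by metis
  define img where "img D = (case D of (T :: real topology, \<phi>, h :: 'a) \<Rightarrow>
    (\<lambda>(t, k). \<phi> t + int_multiple k h) ` (topspace T \<times> J))" for D
  have compact_img: "compact (img E)" if "good P m E" for P m E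
  proof -
    obtain T \<phi> h where E: "E = (T, \<phi>, h)"
      by (cases E)
    let ?Y = "prod_topology T (discrete_topology J)"
    have "compact_space ?Y"
      using that by (auto simp: good_def E compact_space_prod_topology compact_space_discrete_topology J)
    then have "compactin ?Y (topspace ?Y)"
      by (simp add: compact_space_def)
    then have "compactin euclidean ((\<lambda>(t, k). \<phi> t + int_multiple k h) ` topspace ?Y)"
      by (rule image_compactin[OF _ continuous_map_plus_int_multiple])
        (use that in \<open>auto simp: good_def E\<close>)
    then show ?thesis
      by (simp add: img_def E)
  qed
  \<comment> \<open>\<open>Q m\<close> contains all sums of the first \<open>m\<close> summands\<close>
  define Q where "Q = rec_nat {0} (\<lambda>m P. (\<lambda>(a, b). a + b) ` (P \<times> img (D P m)))"
  have Q: "Q 0 = {0}" "\<And>m. Q (Suc m) = (\<lambda>(a, b). a + b) ` (Q m \<times> img (D (Q m) m))"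
    by (simp_all add: Q_def)
  have compact_Q: "compact (Q m)" for m
  proof (induction m)
    case (Suc m)
    have "continuous_on (Q m \<times> img (D (Q m) m)) (\<lambda>(a, b). a + b)"
      unfolding continuous_on_def case_prod_unfold
      by (intro ballI tendsto_add tendsto_fst tendsto_snd tendsto_ident_at)
    then show ?case
      unfolding Q using Suc compact_img[OF D[OF Suc]]
      by (intro compact_continuous_image compact_Times)
  qed (simp add: Q)
  define E where "E m = D (Q m) m" for m
  define T where "T m = fst (E m)" for m
  define \<phi> where "\<phi> m = fst (snd (E m))" for m
  define h where "h m = snd (snd (E m))" for m
  have E: "E m = (T m, \<phi> m, h m)" for m
    by (simp add: T_def \<phi>_def h_def)
  have good: "good (Q m) m (T m, \<phi> m, h m)" for m
    using D[OF compact_Q[of m], of m] by (simp flip: E add: E_def)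
  have img_E: "img (D (Q m) m) = (\<lambda>(t, k). \<phi> m t + int_multiple k (h m)) ` (topspace (T m) \<times> J)" for m
    unfolding E_def[symmetric] by (simp add: E img_def)
  define g where "g i = (\<lambda>(t, k). \<phi> i t + int_multiple k (h i))" for i
  have small: "dist (\<Sum>i<m. g i (p i)) (\<Sum>i<Suc m. g i (p i)) \<le> (1/2) ^ m"
    if p: "\<And>i. p i \<in> topspace (T i) \<times> J" for m p
  proof -
    have in_Q: "(\<Sum>i<m. g i (p i)) \<in> Q m" for m
    proof (induction m)
      case (Suc m)
      have "g m (p m) \<in> img (D (Q m) m)"
        unfolding img_E g_def using p[of m] by (rule imageI)
      then have "(\<Sum>i<m. g i (p i)) + g m (p m) \<in> Q (Suc m)"
        unfolding Q using Suc by (intro image_eqI[of _ _ "(\<Sum>i<m. g i (p i), g m (p m))"]) auto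
      then show ?case by simp
    qed (simp add: Q)
    obtain t k where tk: "p m = (t, k)" "t \<in> topspace (T m)" "k \<in> J"
      using p[of m] by auto
    have "dist a (a + (\<phi> m t + int_multiple k (h m))) < (1/2) ^ m" if "a \<in> Q m" for a
      using good[of m] tk(2,3) that by (simp add: good_def)
    from this[OF in_Q] show ?thesis
      using tk(1) by (simp add: g_def)
  qed
  show thesis
  proof (rule that[of T \<phi> h])
    fix m
    show "compact_space (T m)" "metrizable_space (T m)" "topspace (T m) \<noteq> {}"
      "continuous_map (T m) euclidean (\<phi> m)"
      using good[of m] by (auto simp: good_def)
    show "meager_in (T m) {t \<in> topspace (T m).
        \<phi> m t \<in> translate (\<Inter>k\<in>J. translate C (int_multiple k (h m))) x}" for x
      using good[of m] unfolding good_def prod.case by blast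
    show "dist (\<Sum>i<m. (\<lambda>(t, k). \<phi> i t + int_multiple k (h i)) (p i))
           (\<Sum>i<Suc m. (\<lambda>(t, k). \<phi> i t + int_multiple k (h i)) (p i)) \<le> (1/2) ^ m"
      if "\<forall>i. p i \<in> topspace (T i) \<times> J" for p
      using small[of p m] that unfolding g_def by blast
  qed
qed

section \<open>Changing one coordinate\<close>

lemma continuous_map_update_coordinate:
  assumes e: "continuous_map T (Y m) e"
  shows "continuous_map (prod_topology (product_topology Y UNIV) T) (product_topology Y UNIV)
           (\<lambda>(p, t). p(m := e t))"
  unfolding continuous_map_componentwise_UNIV
proof
  fix i
  let ?Z = "prod_topology (product_topology Y UNIV) T"
  show "continuous_map ?Z (Y i) (\<lambda>q. (case q of (p, t) \<Rightarrow> p(m := e t)) i)"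
  proof (cases "i = m")
    case True
    then show ?thesis
      using continuous_map_compose[OF continuous_map_snd e, of "product_topology Y UNIV"]
      by (simp add: o_def case_prod_unfold)
  next
    case False
    then show ?thesis
      using continuous_map_compose[OF continuous_map_fst continuous_map_product_projection[of i UNIV Y], of T]
      by (simp add: o_def case_prod_unfold)
  qed
qed

text \<open>Overwriting a coordinate forgets its old value, so the image of a box is again a box, with the
  \<open>m\<close>-th side replaced by an open image under \<open>e\<close>.\<close>

lemma open_map_update_coordinate:
  assumes e: "open_map T (Y m) e"
  shows "open_map (prod_topology (product_topology Y UNIV) T) (product_topology Y UNIV)
           (\<lambda>(p, t). p(m := e t))"
  unfolding open_map_def
proof (intro allI impI)
  fix W assume W: "openin (prod_topology (product_topology Y UNIV) T) W"
  show "openin (product_topology Y UNIV) ((\<lambda>(p, t). p(m := e t)) ` W)"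
    unfolding openin_product_topology_alt
  proof
    fix q assume "q \<in> (\<lambda>(p, t). p(m := e t)) ` W"
    then obtain p t where pt: "(p, t) \<in> W" "q = p(m := e t)"
      by auto
    then obtain A B where AB: "openin (product_topology Y UNIV) A" "openin T B"
      "p \<in> A" "t \<in> B" "A \<times> B \<subseteq> W"
      using openin_prod_topology_alt[THEN iffD1, OF W] pt(1) by metis
    then obtain U where U: "finite {i. U i \<noteq> topspace (Y i)}" "\<And>i. openin (Y i) (U i)"
      "p \<in> Pi\<^sub>E UNIV U" "Pi\<^sub>E UNIV U \<subseteq> A"
      using openin_product_topology_alt[THEN iffD1, rule_format, OF AB(1,3)] by auto
    define U' where "U' = U(m := e ` B)"
    have "{i. U' i \<noteq> topspace (Y i)} \<subseteq> insert m {i. U i \<noteq> topspace (Y i)}"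
      by (auto simp: U'_def)
    then have fin: "finite {i \<in> UNIV. U' i \<noteq> topspace (Y i)}"
      using U(1) finite_subset by auto
    have op: "\<forall>i\<in>UNIV. openin (Y i) (U' i)"
      using U(2) e AB(2) by (auto simp: U'_def open_map_def)
    have "q \<in> Pi\<^sub>E UNIV U'"
      using U(3) AB(4) by (auto simp: U'_def pt(2) PiE_iff)
    moreover have "q' \<in> (\<lambda>(p, t). p(m := e t)) ` W" if q': "q' \<in> Pi\<^sub>E UNIV U'" for q'
    proof -
      obtain t' where t': "t' \<in> B" "q' m = e t'"
        using q' by (auto simp: U'_def PiE_iff dest!: spec[of _ m])
      have "q'(m := p m) \<in> Pi\<^sub>E UNIV U"
        using q' U(3) by (auto simp: U'_def PiE_iff split: if_splits)
      then have "(q'(m := p m), t') \<in> W"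
        using U(4) AB(5) t'(1) by blast
      then show ?thesis
        by (rule rev_image_eqI) (auto simp: t'(2)[symmetric])
    qed
    ultimately show "\<exists>U. finite {i \<in> UNIV. U i \<noteq> topspace (Y i)} \<and> (\<forall>i\<in>UNIV. openin (Y i) (U i)) \<and>
        q \<in> Pi\<^sub>E UNIV U \<and> Pi\<^sub>E UNIV U \<subseteq> (\<lambda>(p, t). p(m := e t)) ` W"
      using fin op by (intro exI[of _ U'] conjI subsetI)
  qed
qed

lemma continuous_open_map_slice:
  fixes T :: "'b topology"
  assumes "k \<in> J"
  shows "continuous_map T (prod_topology T (discrete_topology J)) (\<lambda>t. (t, k))"
    and "open_map T (prod_topology T (discrete_topology J)) (\<lambda>t. (t, k))"
proof -
  show "continuous_map T (prod_topology T (discrete_topology J)) (\<lambda>t. (t, k))"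
    using assms by (simp add: continuous_map_pairedI)
  have "(\<lambda>t. (t, k)) ` U = U \<times> {k}" for U :: "'b set"
    by auto
  then show "open_map T (prod_topology T (discrete_topology J)) (\<lambda>t. (t, k))"
    using assms by (simp add: open_map_def openin_prod_Times_iff)
qed

section \<open>The infinite convolution argument\<close>

text \<open>The heart of the matter. The space \<open>Z\<close> is the product of the spaces \<open>T m \<times> J\<close>, and \<open>f\<close> sends the sequence
  of pairs \<open>(t\<^sub>m, k\<^sub>m)\<close> to \<open>\<Sum>m. \<phi> m t\<^sub>m + k\<^sub>m h m\<close>. If some \<open>f\<^sup>-\<^sup>1 (C + x)\<close> were nonmeager, it would be comeager
  in a box \<open>H\<close>, which leaves some coordinate \<open>m\<close> unrestricted. By Kuratowski--Ulam, almost every way of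
  fixing the other coordinates has the property that, for almost all \<open>t\<close> and for every \<open>k \<in> J\<close>
  simultaneously, setting the \<open>m\<close>-th coordinate to \<open>(t, k)\<close> keeps \<open>f\<close> in \<open>C + x\<close>. So \<open>\<phi> m\<close> sends almost every
  \<open>t\<close> into a translate of the intersection of the shifts of \<open>C\<close> by multiples of \<open>h m\<close>, which is what \<open>\<phi> m\<close>
  was chosen to avoid.\<close>

lemma haar_meager_if_frequently_haar_meager_Inter:
  fixes C :: "'a::{topological_ab_group_add, polish_space} set"
  assumes C: "C \<in> sets borel"
    and J: "finite J" "0 \<in> J" "\<And>k. k \<in> J \<Longrightarrow> - k \<in> J"
    and freq: "\<exists>\<^sub>F h in nhds 0. haar_meager (\<Inter>k\<in>J. translate C (int_multiple k h))"
  shows "haar_meager C"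
proof -
  obtain T :: "nat \<Rightarrow> real topology" and \<phi> h where
    T: "\<And>m. compact_space (T m)" "\<And>m. metrizable_space (T m)" "\<And>m. topspace (T m) \<noteq> {}"
    and \<phi>: "\<And>m. continuous_map (T m) euclidean (\<phi> m)"
    and meager: "\<And>m x. meager_in (T m) {t \<in> topspace (T m).
        \<phi> m t \<in> translate (\<Inter>k\<in>J. translate C (int_multiple k (h m))) x}"
    and small: "\<And>m p. \<forall>i. p i \<in> topspace (T i) \<times> J \<Longrightarrow>
      dist (\<Sum>i<m. (\<lambda>(t, k). \<phi> i t + int_multiple k (h i)) (p i))
           (\<Sum>i<Suc m. (\<lambda>(t, k). \<phi> i t + int_multiple k (h i)) (p i)) \<le> (1/2) ^ m"
  proof (rule summable_meager_witnesses[OF freq J(1)], goal_cases)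
    case (1 T \<phi> h)
    from 1(2-) show thesis by (rule 1(1))
  qed
  define Y where "Y m = prod_topology (T m) (discrete_topology J)" for m
  define g where "g m = (\<lambda>(t, k). \<phi> m t + int_multiple k (h m))" for m
  define Z where "Z = product_topology Y UNIV"
  have Y: "topspace (Y m) = topspace (T m) \<times> J" for m
    by (simp add: Y_def)
  have Z: "p \<in> topspace Z \<longleftrightarrow> (\<forall>i. p i \<in> topspace (Y i))" for p
    by (auto simp: Z_def PiE_iff)
  have compact_Z: "compact_space Z"
    using T(1) by (simp add: Z_def Y_def compact_space_product_topology compact_space_prod_topology
        compact_space_discrete_topology J(1))
  have metrizable_Z: "metrizable_space Z"
    using T(2) by (simp add: Z_def Y_def metrizable_space_product_topology metrizable_space_prod_topology)
  obtain f where f: "continuous_map Z euclidean f"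
    and upd: "\<And>p m y. p \<in> topspace Z \<Longrightarrow> y \<in> topspace (Y m) \<Longrightarrow>
       f (p(m := y)) = f p - g m (p m) + g m y"
  proof (rule continuous_map_infinite_sum[of Y g, folded Z_def], goal_cases)
    case (1 i)
    show ?case
      unfolding Y_def g_def by (rule continuous_map_plus_int_multiple[OF \<phi>])
  next
    case (2 p m)
    then show ?case
      unfolding g_def by (intro small) (simp add: Z Y)
  next
    case (3 f)
    from 3(2-) show thesis by (rule 3(1))
  qed
  have meager_Z: "meager_in Z {p \<in> topspace Z. f p \<in> translate C x}" for x
  proof (rule ccontr)
    define S where "S = {p \<in> topspace Z. f p \<in> translate C x}"
    assume "\<not> meager_in Z {p \<in> topspace Z. f p \<in> translate C x}"
    then have nm: "\<not> meager_in Z S"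
      by (simp add: S_def)
    obtain G where G: "openin Z G" "meager_in Z (sym_diff G S)"
      using borel_vimage_Baire_property[OF f borel_translate[OF C, of x]] unfolding S_def by auto
    have "G \<noteq> {}"
      using nm G(2) by auto
    then obtain p0 where "p0 \<in> G" by blast
    then obtain U where U: "finite {i. U i \<noteq> topspace (Y i)}" "\<And>i. openin (Y i) (U i)"
      "p0 \<in> Pi\<^sub>E UNIV U" "Pi\<^sub>E UNIV U \<subseteq> G"
      using openin_product_topology_alt[THEN iffD1, rule_format, OF G(1)[unfolded Z_def] \<open>p0 \<in> G\<close>]
      by auto
    \<comment> \<open>a coordinate on which the box imposes no condition: moving it keeps a point in the box\<close>
    obtain m where "m \<notin> {i. U i \<noteq> topspace (Y i)}"
      using U(1) ex_new_if_finite infinite_UNIV_nat by blast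
    then have m: "U m = topspace (Y m)"
      by simp
    define H where "H = Pi\<^sub>E UNIV U"
    have H: "openin Z H" "H \<noteq> {}"
      using U(1-3) unfolding H_def Z_def by (auto simp: openin_PiE_gen)
    define u :: "int \<Rightarrow> (nat \<Rightarrow> real \<times> int) \<times> real \<Rightarrow> nat \<Rightarrow> real \<times> int" where "u k = (\<lambda>(p, t). p(m := (t, k)))" for k
    have "meager_in Z (G - S)"
      using G(2) by (rule meager_in_subset) auto
    then have "meager_in (prod_topology Z (T m)) {q \<in> topspace (prod_topology Z (T m)). u k q \<in> G - S}"
      if "k \<in> J" for k
      unfolding u_def Z_def
      by (intro meager_in_open_map_vimage[where Y = "product_topology Y UNIV"]
          continuous_map_update_coordinate open_map_update_coordinate)
        (auto simp: Y_def that continuous_open_map_slice)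
    note meager_in_sections[OF T(1,2) this]
    then have "meager_in Z (\<Union>k\<in>J. {p \<in> topspace Z. \<not> meager_in (T m)
        {t \<in> topspace (T m). (p, t) \<in> {q \<in> topspace (prod_topology Z (T m)). u k q \<in> G - S}}})"
      by (intro meager_in_countable_Union) (use J(1) in \<open>simp_all add: countable_finite\<close>)
    then obtain p where p: "p \<in> H" and p_not: "p \<notin> (\<Union>k\<in>J. {p \<in> topspace Z. \<not> meager_in (T m)
        {t \<in> topspace (T m). (p, t) \<in> {q \<in> topspace (prod_topology Z (T m)). u k q \<in> G - S}}})"
      using open_not_meager_in[OF compact_Z metrizable_Z H] meager_in_subset by blast
    have p_Z: "p \<in> topspace Z"
      using p H(1) openin_subset by blast
    \<comment> \<open>the contribution of all coordinates other than \<open>m\<close>\<close>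
    define a where "a = f p - g m (p m)"
    have bad: "meager_in (T m) {t \<in> topspace (T m). a + g m (t, k) \<notin> translate C x}" if "k \<in> J" for k
    proof -
      have "meager_in (T m)
          {t \<in> topspace (T m). (p, t) \<in> {q \<in> topspace (prod_topology Z (T m)). u k q \<in> G - S}}"
        using p_not p_Z that by blast
      then show ?thesis
      proof (rule meager_in_subset, intro subsetI)
        fix t assume t: "t \<in> {t \<in> topspace (T m). a + g m (t, k) \<notin> translate C x}"
        then have tk: "(t, k) \<in> topspace (Y m)"
          using that by (simp add: Y)
        have "p(m := (t, k)) \<in> H"
          using p tk m by (auto simp: H_def PiE_iff)
        moreover have "f (p(m := (t, k))) = a + g m (t, k)"
          using upd[of p "(t, k)" m] tk p_Z by (simp add: a_def)
        ultimately have "u k (p, t) \<in> G - S"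
          using t U(4) by (auto simp: u_def H_def S_def)
        then show "t \<in> {t \<in> topspace (T m). (p, t) \<in>
            {q \<in> topspace (prod_topology Z (T m)). u k q \<in> G - S}}"
          using t p_Z by simp
      qed
    qed
    have "topspace (T m) \<subseteq>
        {t \<in> topspace (T m). \<phi> m t \<in> translate (\<Inter>k\<in>J. translate C (int_multiple k (h m))) (x - a)} \<union>
        (\<Union>k\<in>J. {t \<in> topspace (T m). a + g m (t, k) \<notin> translate C x})"
    proof
      fix t assume t: "t \<in> topspace (T m)"
      show "t \<in> {t \<in> topspace (T m). \<phi> m t \<in> translate (\<Inter>k\<in>J. translate C (int_multiple k (h m))) (x - a)} \<union>
        (\<Union>k\<in>J. {t \<in> topspace (T m). a + g m (t, k) \<notin> translate C x})"
      proof (cases "\<forall>k\<in>J. a + g m (t, k) \<in> translate C x")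
        case True
        have "\<phi> m t - (x - a) - int_multiple k (h m) \<in> C" if "k \<in> J" for k
        proof -
          \<comment> \<open>adding \<open>- k h\<close> while staying in \<open>C + x\<close> means lying in the shift by \<open>+ k h\<close>, hence the sign\<close>
          have "a + g m (t, - k) \<in> translate C x"
            using True J(3)[OF that] by blast
          then show ?thesis
            by (simp add: mem_translate_iff g_def int_multiple_minus_left algebra_simps)
        qed
        then show ?thesis
          using t by (simp add: mem_translate_iff)
      qed (use t in blast)
    qed
    moreover have "meager_in (T m)
       ({t \<in> topspace (T m). \<phi> m t \<in> translate (\<Inter>k\<in>J. translate C (int_multiple k (h m))) (x - a)} \<union>
        (\<Union>k\<in>J. {t \<in> topspace (T m). a + g m (t, k) \<notin> translate C x}))"
      using bad by (intro meager_in_Un meager meager_in_countable_Union) (use J(1) in \<open>simp_all add: countable_finite\<close>)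
    ultimately have "meager_in (T m) (topspace (T m))"
      by (rule meager_in_subset[rotated])
    then show False
      using open_not_meager_in[OF T(1,2) openin_topspace T(3)] by blast
  qed
  obtain M d where Md: "Metric_space M d" "Z = Metric_space.mtopology M d"
    using metrizable_Z by (auto simp: metrizable_space_def)
  define K where "K = metric (M, d)"
  have K: "mtopology_of K = Z" "mspace K = topspace Z"
    using Md by (simp_all add: K_def Metric_space.mtopology_of Metric_space.mspace_metric
        Metric_space.topspace_mtopology)
  have "(\<lambda>i. (SOME t. t \<in> topspace (T i), 0)) \<in> topspace Z"
    using T(3) J(2) by (auto simp: Z Y some_in_eq)
  then have "haar_meager_witness C K f"
    unfolding haar_meager_witness_def K using compact_Z f meager_Z by blast
  then show ?thesis
    using C by (intro haar_meagerI[of C C]) auto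
qed

text \<open>With \<open>C\<close> the intersection belonging to a point \<open>x0\<close>, the intersection of the shifts of \<open>C\<close> by the multiples
  of \<open>h\<close> is contained in the intersection belonging to \<open>x0 + h\<close>. Hence Haar meagerness at points arbitrarily near
  to \<open>x0\<close> would make \<open>C\<close> itself Haar meager.\<close>

theorem theorem4:
  fixes A :: "'a::{topological_ab_group_add, polish_space} set" and n :: nat
  assumes "A \<in> sets borel" and "\<not> haar_meager A" and "n \<ge> 1"
  shows "open (F_set n A) \<and> F_set n A \<noteq> {}"
proof
  define J where "J = {- int n..int n}"
  have J: "finite J" "0 \<in> J" "\<And>k. k \<in> J \<Longrightarrow> - k \<in> J"
    by (auto simp: J_def)
  have F: "x \<in> F_set n A \<longleftrightarrow> \<not> haar_meager (\<Inter>k\<in>J. translate A (int_multiple k x))" for x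
    by (simp add: F_set_def J_def)
  have "\<forall>\<^sub>F x in nhds x0. x \<in> F_set n A" if x0: "x0 \<in> F_set n A" for x0
  proof (rule ccontr)
    define C where "C = (\<Inter>k\<in>J. translate A (int_multiple k x0))"
    have C: "C \<in> sets borel" "\<not> haar_meager C"
      using x0 borel_translate[OF assms(1)] unfolding F C_def
      by (auto simp: J_def intro!: sets.finite_INT)
    have sub: "(\<Inter>k\<in>J. translate C (int_multiple k h)) \<subseteq>
        (\<Inter>k\<in>J. translate A (int_multiple k (h + x0)))" for h
      by (auto simp: C_def mem_translate_iff int_multiple_add_right diff_diff_eq)
    assume "\<not> (\<forall>\<^sub>F x in nhds x0. x \<in> F_set n A)"
    then have "\<exists>\<^sub>F x in nhds x0. haar_meager (\<Inter>k\<in>J. translate A (int_multiple k x))"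
      by (simp add: frequently_def F)
    moreover have shift: "\<forall>\<^sub>F x in nhds x0. P x" if "\<forall>\<^sub>F h in nhds 0. P (h + x0)" for P
    proof -
      have "filterlim (\<lambda>x. x - x0) (nhds (x0 - x0)) (nhds x0)"
        by (intro tendsto_diff filterlim_ident tendsto_const)
      then have "filterlim (\<lambda>x. x - x0) (nhds 0) (nhds x0)"
        by simp
      from eventually_compose_filterlim[OF that this] show ?thesis
        by simp
    qed
    ultimately have "\<exists>\<^sub>F h in nhds 0. haar_meager (\<Inter>k\<in>J. translate A (int_multiple k (h + x0)))"
      unfolding frequently_def
      using shift[of "\<lambda>x. \<not> haar_meager (\<Inter>k\<in>J. translate A (int_multiple k x))"] by blast
    then have "\<exists>\<^sub>F h in nhds 0. haar_meager (\<Inter>k\<in>J. translate C (int_multiple k h))"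
      by (rule frequently_elim1) (rule haar_meager_mono[OF _ sub])
    then show False
      using haar_meager_if_frequently_haar_meager_Inter[OF C(1) J] C(2) by blast
  qed
  then have "\<exists>U. open U \<and> x0 \<in> U \<and> U \<subseteq> F_set n A" if "x0 \<in> F_set n A" for x0
    using that unfolding eventually_nhds subset_eq by simp
  then show "open (F_set n A)"
    by (subst open_subopen) blast
  have "(\<Inter>k\<in>J. translate A (int_multiple k 0)) = A"
    by (auto simp: mem_translate_iff J_def)
  then have "0 \<in> F_set n A"
    using assms(2) F by simp
  then show "F_set n A \<noteq> {}"
    by blast
qed

end
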